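(* Let $\Gamma\subset\mathrm{PSL}_2(\mathbb R)$ be a Fuchsian group of the first kind with at least one cusp and let $E=E_2^\Gamma\in Q_2(\Gamma)$ satisfy $E_2^\Gamma|_2\gamma=E_2^\Gamma+\frac{12}{2\pi i}X(\gamma,\tau)$ for all $\gamma\in\Gamma$. Then: (i) $E_4^\Gamma:=E^2-12\,\theta E\in M_4(\Gamma)$, and consequently $$\theta E_2^\Gamma=\frac1{12}\big((E_2^\Gamma)^2-E_4^\Gamma\big);$$ (ii) for every $h\in M_{k'}(\Gamma)$, $\vartheta(h):=\theta h-\frac{k'}{12}E_2^\Gamma h\in M_{k'+2}(\Gamma)$, i.e. $$\theta h=\frac{k'}{12}E_2^\Gamma h+\vartheta(h).$$
   Context: $\theta=q\,d/dq=\frac1{2\pi i}\frac{d}{d\tau}$, $q=e^{2\pi i\tau}$. A Fuchsian group of the first kind is a finitely generated discrete subgroup of $\mathrm{PSL}_2(\mathbb R)$ of finite covolume; elements are lifted to $\mathrm{SL}_2(\mathbb R)$ (full preimage). For $\gamma=\begin{pmatrix}a&b\\c&d\end{pmatrix}$: $j(\gamma,\tau)=c\tau+d$, $X(\gamma,\tau)=c/j(\gamma,\tau)$, $f|_k\gamma(\tau)=j(\gamma,\tau)^{-k}f(\gamma\tau)$. $Q_k(\Gamma)$: holomorphic $f:\mathbb H\to\mathbb C$ for which there are $s\ge0$ and holomorphic $Q_0(f)=f,\dots,Q_s(f)$ with $f|_k\gamma(\tau)=\sum_{m=0}^sX(\gamma,\tau)^mQ_m(f)(\tau)$ for all $\gamma\in\Gamma$,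 holomorphic at the cusps: for every $\sigma\in\mathrm{SL}_2(\mathbb R)$ with $\sigma\infty$ a cusp and every $m$, $Q_m(f)|_{k-2m}\sigma$ is bounded as $\mathrm{Im}\,\tau\to\infty$, uniformly for $\mathrm{Re}\,\tau$ in compact sets. $M_k(\Gamma)\subset Q_k(\Gamma)$ is the subspace of $f$ with $f|_k\gamma=f$ for all $\gamma\in\Gamma$. *)

theory Defs
  imports
    "HOL-Analysis.Analysis"
    "HOL-Algebra.Coset"
    "HOL-Algebra.Generated_Groups"
begin

section \<open>The groups SL(2,R) and PSL(2,R)\<close>

definition SL2R :: "(real^2^2) monoid" where
  "SL2R = \<lparr>carrier = {A. det A = 1}, mult = (**), one = mat 1\<rparr>"

definition pm_one :: "(real^2^2) set" where
  "pm_one = {mat 1, - mat 1}"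

definition PSL2R :: "(real^2^2) set monoid" where
  "PSL2R = SL2R Mod pm_one"

text \<open>The quotient topology: elements of PSL(2,R) are cosets, so the preimage of a set
  \<open>U\<close> of such elements under the projection is just \<open>\<Union>U\<close>.\<close>

definition PSL2R_topology :: "(real^2^2) set topology" where
  "PSL2R_topology = topology (\<lambda>U. U \<subseteq> carrier PSL2R \<and> openin (top_of_set (carrier SL2R)) (\<Union>U))"

text \<open>The full preimage in SL(2,R) of a set of elements of PSL(2,R).\<close>

definition lifts :: "(real^2^2) set set \<Rightarrow> (real^2^2) set" where
  "lifts \<Gamma> = \<Union>\<Gamma>"


section \<open>Actions on the upper half-plane and on its boundary\<close>

definition upper_half_plane :: "complex set" where
  "upper_half_plane = {\<tau>. Im \<tau> > 0}"

definition jfac :: "real^2^2 \<Rightarrow> complex \<Rightarrow> complex" where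
  "jfac A \<tau> = complex_of_real (A$2$1) * \<tau> + complex_of_real (A$2$2)"

definition Xfac :: "real^2^2 \<Rightarrow> complex \<Rightarrow> complex" where
  "Xfac A \<tau> = complex_of_real (A$2$1) / jfac A \<tau>"

definition mob :: "real^2^2 \<Rightarrow> complex \<Rightarrow> complex" where
  "mob A \<tau> = (complex_of_real (A$1$1) * \<tau> + complex_of_real (A$1$2)) / jfac A \<tau>"

definition slash :: "int \<Rightarrow> (complex \<Rightarrow> complex) \<Rightarrow> real^2^2 \<Rightarrow> complex \<Rightarrow> complex" where
  "slash k f A \<tau> = jfac A \<tau> powi (- k) * f (mob A \<tau>)"

text \<open>The boundary is \<open>\<real> \<union> {\<infinity>}\<close>, with \<open>None\<close> playing the role of \<open>\<infinity>\<close>.\<close>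

definition mob_boundary :: "real^2^2 \<Rightarrow> real option \<Rightarrow> real option" where
  "mob_boundary A x = (case x of
     None \<Rightarrow> (if A$2$1 = 0 then None else Some (A$1$1 / A$2$1))
   | Some t \<Rightarrow> (if A$2$1 * t + A$2$2 = 0 then None
               else Some ((A$1$1 * t + A$1$2) / (A$2$1 * t + A$2$2))))"


section \<open>Fuchsian groups of the first kind and their cusps\<close>

definition parabolic :: "real^2^2 \<Rightarrow> bool" where
  "parabolic A \<longleftrightarrow> A \<in> carrier SL2R \<and> A \<notin> pm_one \<and> \<bar>trace A\<bar> = 2"

definition is_cusp :: "(real^2^2) set set \<Rightarrow> real option \<Rightarrow> bool" where
  "is_cusp \<Gamma> x \<longleftrightarrow> (\<exists>A \<in> lifts \<Gamma>. parabolic A \<and> mob_boundary A x = x)"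

definition fundamental_set :: "(real^2^2) set set \<Rightarrow> complex set \<Rightarrow> bool" where
  "fundamental_set \<Gamma> F \<longleftrightarrow> F \<in> sets borel \<and> F \<subseteq> upper_half_plane \<and>
     (\<forall>\<tau> \<in> upper_half_plane. \<exists>!w. w \<in> F \<and> (\<exists>A \<in> lifts \<Gamma>. w = mob A \<tau>))"

definition hyperbolic_area :: "complex set \<Rightarrow> ennreal" where
  "hyperbolic_area F = (\<integral>\<^sup>+ \<tau> \<in> F. ennreal (1 / (Im \<tau>)\<^sup>2) \<partial>lborel)"

text \<open>The covolume is the hyperbolic area of any Borel set of orbit representatives;
  for a discrete group such a set exists and the area does not depend on its choice.\<close>

definition finite_covolume :: "(real^2^2) set set \<Rightarrow> bool" where
  "finite_covolume \<Gamma> \<longleftrightarrow> (\<exists>F. fundamental_set \<Gamma> F \<and> hyperbolic_area F < \<infinity>)"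

definition fuchsian_first_kind :: "(real^2^2) set set \<Rightarrow> bool" where
  "fuchsian_first_kind \<Gamma> \<longleftrightarrow>
     subgroup \<Gamma> PSL2R \<and>
     subtopology PSL2R_topology \<Gamma> = discrete_topology \<Gamma> \<and>
     (\<exists>S. finite S \<and> S \<subseteq> carrier PSL2R \<and> \<Gamma> = generate PSL2R S) \<and>
     finite_covolume \<Gamma>"


section \<open>Quasimodular and modular forms\<close>

text \<open>Forms are functions on the complex plane of which only the restriction to the upper
  half-plane matters.\<close>

definition bounded_towards_infinity :: "(complex \<Rightarrow> complex) \<Rightarrow> bool" where
  "bounded_towards_infinity g \<longleftrightarrow>
     (\<forall>K::real set. compact K \<longrightarrow>
        (\<exists>Y>0. \<exists>B. \<forall>\<tau>. Re \<tau> \<in> K \<and> Im \<tau> \<ge> Y \<longrightarrow> norm (g \<tau>) \<le> B))"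

definition quasimodular_forms :: "int \<Rightarrow> (real^2^2) set set \<Rightarrow> (complex \<Rightarrow> complex) set" where
  "quasimodular_forms k \<Gamma> =
     {f. f holomorphic_on upper_half_plane \<and>
         (\<exists>(s::nat) Q.
            (\<forall>m\<le>s. Q m holomorphic_on upper_half_plane) \<and>
            (\<forall>\<tau> \<in> upper_half_plane. Q 0 \<tau> = f \<tau>) \<and>
            (\<forall>A \<in> lifts \<Gamma>. \<forall>\<tau> \<in> upper_half_plane.
               slash k f A \<tau> = (\<Sum>m\<le>s. Xfac A \<tau> ^ m * Q m \<tau>)) \<and>
            (\<forall>\<sigma> \<in> carrier SL2R. is_cusp \<Gamma> (mob_boundary \<sigma> None) \<longrightarrow>
               (\<forall>m\<le>s. bounded_towards_infinity (slash (k - 2 * int m) (Q m) \<sigma>))))}"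

definition modular_forms :: "int \<Rightarrow> (real^2^2) set set \<Rightarrow> (complex \<Rightarrow> complex) set" where
  "modular_forms k \<Gamma> =
     {f \<in> quasimodular_forms k \<Gamma>.
        \<forall>A \<in> lifts \<Gamma>. \<forall>\<tau> \<in> upper_half_plane. slash k f A \<tau> = f \<tau>}"

text \<open>The derivation \<open>\<theta> = q d/dq\<close> with \<open>q = exp (2\<pi>i\<tau>)\<close>.\<close>

definition theta :: "(complex \<Rightarrow> complex) \<Rightarrow> complex \<Rightarrow> complex" where
  "theta f \<tau> = 1 / (2 * of_real pi * \<i>) * deriv f \<tau>"

definition E4_of :: "(complex \<Rightarrow> complex) \<Rightarrow> complex \<Rightarrow> complex" where
  "E4_of E \<tau> = (E \<tau>)\<^sup>2 - 12 * theta E \<tau>"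

definition serre_deriv :: "(complex \<Rightarrow> complex) \<Rightarrow> int \<Rightarrow> (complex \<Rightarrow> complex) \<Rightarrow> complex \<Rightarrow> complex" where
  "serre_deriv E k h \<tau> = theta h \<tau> - of_int k / 12 * E \<tau> * h \<tau>"


section \<open>Well-definedness of the quotient group and its topology\<close>

lemma carrier_SL2R [simp]: "A \<in> carrier SL2R \<longleftrightarrow> det A = 1"
  and mult_SL2R [simp]: "A \<otimes>\<^bsub>SL2R\<^esub> B = A ** B"
  and one_SL2R [simp]: "\<one>\<^bsub>SL2R\<^esub> = mat 1"
  by (simp_all add: SL2R_def)

lemma group_SL2R: "group SL2R"
proof (rule groupI)
  fix A assume A: "A \<in> carrier SL2R"
  hence "invertible A" by (simp add: invertible_det_nz)
  then obtain B where B: "A ** B = mat 1" "B ** A = mat 1"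
    by (auto simp: invertible_def)
  have "det B = 1" using arg_cong[OF B(1), of det] A by (simp add: det_mul)
  thus "\<exists>B \<in> carrier SL2R. B \<otimes>\<^bsub>SL2R\<^esub> A = \<one>\<^bsub>SL2R\<^esub>" using B by auto
qed (auto simp: det_mul matrix_mul_assoc)

lemma minus_matrix_mul: "(- A) ** B = - (A ** B)" "A ** (- B) = - (A ** B)"
  for A B :: "real^2^2"
  by (simp_all add: matrix_matrix_mult_def vec_eq_iff sum_negf)

lemma det_pm_one: "A \<in> pm_one \<Longrightarrow> det A = 1"
  by (auto simp: pm_one_def det_2 mat_def)

lemma normal_pm_one: "pm_one \<lhd> SL2R"
proof -
  interpret group SL2R by (rule group_SL2R)
  have "subgroup pm_one SL2R"
  proof (rule subgroupI)
    fix A assume A: "A \<in> pm_one"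
    have "A ** A = mat 1"
      using A by (auto simp: pm_one_def minus_matrix_mul)
    with det_pm_one[OF A] have "inv\<^bsub>SL2R\<^esub> A = A" by (intro inv_equality) auto
    thus "inv\<^bsub>SL2R\<^esub> A \<in> pm_one" using A by simp
  next
    show "pm_one \<subseteq> carrier SL2R" using det_pm_one by auto
  qed (auto simp: pm_one_def minus_matrix_mul)
  moreover have "A \<otimes>\<^bsub>SL2R\<^esub> h \<otimes>\<^bsub>SL2R\<^esub> inv\<^bsub>SL2R\<^esub> A \<in> pm_one"
    if A: "A \<in> carrier SL2R" and h: "h \<in> pm_one" for A h
    using r_inv[OF A] h by (auto simp: pm_one_def minus_matrix_mul)
  ultimately show ?thesis by (simp add: normal_inv_iff)
qed

lemma group_PSL2R: "group PSL2R"
  unfolding PSL2R_def by (rule normal.factorgroup_is_group[OF normal_pm_one])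

lemma carrier_PSL2R: "carrier PSL2R = (\<lambda>A. {A, - A}) ` carrier SL2R"
  by (auto simp: PSL2R_def FactGroup_def RCOSETS_def r_coset_def pm_one_def minus_matrix_mul
      intro!: image_eqI)

lemma openin_PSL2R_topology:
  "openin PSL2R_topology U \<longleftrightarrow> U \<subseteq> carrier PSL2R \<and> openin (top_of_set (carrier SL2R)) (\<Union>U)"
proof -
  have "istopology (\<lambda>U. U \<subseteq> carrier PSL2R \<and> openin (top_of_set (carrier SL2R)) (\<Union>U))"
    unfolding istopology_def
  proof (intro conjI allI impI)
    fix S T
    assume S: "S \<subseteq> carrier PSL2R \<and> openin (top_of_set (carrier SL2R)) (\<Union>S)"
      and T: "T \<subseteq> carrier PSL2R \<and> openin (top_of_set (carrier SL2R)) (\<Union>T)"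
    have disj: "X = Y" if "X \<in> S" "Y \<in> T" "A \<in> X" "A \<in> Y" for X Y A
    proof -
      have "X \<in> carrier PSL2R" "Y \<in> carrier PSL2R" using that S T by auto
      thus ?thesis using that(3,4) by (auto simp: carrier_PSL2R)
    qed
    have "\<Union>(S \<inter> T) = \<Union>S \<inter> \<Union>T" using disj by blast
    thus "openin (top_of_set (carrier SL2R)) (\<Union>(S \<inter> T))" using S T by (metis openin_Int)
    show "S \<inter> T \<subseteq> carrier PSL2R" using S by auto
  next
    fix \<K> assume K: "\<forall>S\<in>\<K>. S \<subseteq> carrier PSL2R \<and> openin (top_of_set (carrier SL2R)) (\<Union>S)"
    have "\<Union>(\<Union>\<K>) = \<Union>(Union ` \<K>)" by auto
    moreover have "openin (top_of_set (carrier SL2R)) (\<Union>(Union ` \<K>))"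
      using K by (intro openin_Union) auto
    ultimately show "openin (top_of_set (carrier SL2R)) (\<Union>(\<Union>\<K>))" by simp
    show "\<Union>\<K> \<subseteq> carrier PSL2R" using K by auto
  qed
  thus ?thesis by (simp add: PSL2R_topology_def topology_inverse')
qed

end

theory Submission
  imports Defs "HOL-Complex_Analysis.Cauchy_Integral_Formula"
begin

text \<open>
  Write \<open>w = 2\<pi>i\<close>.  Everything rests on the chain rule for the slash action,
  \<open>(\<theta> f)|\<^sub>k\<^sub>+\<^sub>2 A = \<theta> (f|\<^sub>k A) + (k / w) X(A) f|\<^sub>k A\<close>, valid for every \<open>A\<close> in SL(2,R)
  (lemma \<open>slash_theta\<close>): differentiation destroys modularity only through a multiple of \<open>X\<close>.
  It is used twice, for two different kinds of matrices.

  For \<open>A\<close> above \<open>\<Gamma>\<close> it gives the transformation laws.  If \<open>h|\<^sub>k A = h\<close>, the defect of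
  \<open>\<theta> h\<close> is \<open>(k / w) X h\<close>, which is \<open>k / 12\<close> times the defect \<open>(12 / w) X h\<close> of \<open>E h\<close>.
  For \<open>E\<close> itself one also needs \<open>\<theta> X = - X\<^sup>2 / w\<close>; then \<open>12 \<theta> E\<close> and \<open>E\<^sup>2\<close>
  both have the defect \<open>2 a X E + a\<^sup>2 X\<^sup>2\<close> with \<open>a = 12 / w\<close>.

  For \<open>\<sigma>\<close> moving \<open>\<infinity>\<close> to a cusp it gives boundedness.  The function \<open>f|\<^sub>k \<sigma>\<close> is bounded high
  up in every vertical strip by hypothesis, its derivative is so by Cauchy's
  inequality on discs of radius 1 in a slightly wider strip, and \<open>\<bar>X(\<sigma>, \<tau>)\<bar> \<le> 1 / Im \<tau>\<close>.
  Hence \<open>(\<theta> f)|\<^sub>k\<^sub>+\<^sub>2 \<sigma>\<close> is bounded as well (lemma \<open>bounded_slash_theta\<close>), and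
  boundedness passes to sums and products.
\<close>

section \<open>The action of SL(2,R) on the upper half-plane\<close>

lemma open_upper_half_plane: "open upper_half_plane"
  by (simp add: upper_half_plane_def open_halfspace_Im_gt)

text \<open>The imaginary part of \<open>c\<tau> + d\<close> vanishes only for \<open>c = 0\<close>, and then \<open>ad = 1\<close> keeps \<open>d\<close>
  away from zero.\<close>

lemma jfac_nonzero:
  assumes "det A = 1" "\<tau> \<in> upper_half_plane"
  shows "jfac A \<tau> \<noteq> 0"
proof
  assume "jfac A \<tau> = 0"
  hence "Im (jfac A \<tau>) = 0" "Re (jfac A \<tau>) = 0" by simp_all
  hence "A$2$1 = 0" "A$2$2 = 0"
    using assms(2) by (auto simp: jfac_def upper_half_plane_def)
  thus False using assms(1) by (simp add: det_2)
qed

lemma Im_mob: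
  assumes "det A = 1"
  shows "Im (mob A \<tau>) = Im \<tau> / (norm (jfac A \<tau>))\<^sup>2"
proof -
  have "Im (mob A \<tau>) = (A$1$1 * A$2$2 - A$1$2 * A$2$1) * Im \<tau> / (norm (jfac A \<tau>))\<^sup>2"
    unfolding mob_def Im_divide cmod_power2 by (simp add: jfac_def algebra_simps)
  thus ?thesis using assms by (simp add: det_2)
qed

lemma mob_in_upper_half_plane:
  assumes "det A = 1" "\<tau> \<in> upper_half_plane"
  shows "mob A \<tau> \<in> upper_half_plane"
  using assms jfac_nonzero[OF assms] by (simp add: upper_half_plane_def Im_mob)

lemma jfac_has_derivative:
  "(jfac A has_field_derivative complex_of_real (A$2$1)) (at \<tau>)"
  unfolding jfac_def by (auto intro!: derivative_eq_intros)

lemma mob_has_derivative: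
  assumes "det A = 1" "\<tau> \<in> upper_half_plane"
  shows "(mob A has_field_derivative 1 / (jfac A \<tau>)\<^sup>2) (at \<tau>)"
proof -
  have "complex_of_real (A$1$1) * complex_of_real (A$2$2)
      - complex_of_real (A$1$2) * complex_of_real (A$2$1) = of_real (det A)"
    by (simp add: det_2)
  hence det: "complex_of_real (A$1$1) * complex_of_real (A$2$2)
      = 1 + complex_of_real (A$1$2) * complex_of_real (A$2$1)"
    using assms(1) by (simp add: algebra_simps)
  have "((\<lambda>t. (complex_of_real (A$1$1) * t + complex_of_real (A$1$2)) / jfac A t)
      has_field_derivative
        (complex_of_real (A$1$1) * jfac A \<tau>
          - (complex_of_real (A$1$1) * \<tau> + complex_of_real (A$1$2)) * complex_of_real (A$2$1))
        / (jfac A \<tau> * jfac A \<tau>)) (at \<tau>)"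
    using jfac_nonzero[OF assms]
    by (intro DERIV_divide jfac_has_derivative) (auto intro!: derivative_eq_intros)
  moreover have "complex_of_real (A$1$1) * jfac A \<tau>
      - (complex_of_real (A$1$1) * \<tau> + complex_of_real (A$1$2)) * complex_of_real (A$2$1) = 1"
    using det by (simp add: jfac_def algebra_simps)
  ultimately show ?thesis by (simp add: mob_def[abs_def] power2_eq_square)
qed

lemma Xfac_has_derivative:
  assumes "det A = 1" "\<tau> \<in> upper_half_plane"
  shows "(Xfac A has_field_derivative - (Xfac A \<tau>)\<^sup>2) (at \<tau>)"
  unfolding Xfac_def[abs_def]
  by (rule derivative_eq_intros jfac_has_derivative jfac_nonzero[OF assms] refl)+
     (simp add: power2_eq_square)

lemma lifts_det:
  assumes "subgroup \<Gamma> PSL2R" "A \<in> lifts \<Gamma>"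
  shows "det A = 1"
proof -
  from assms subgroup.subset obtain B where "A \<in> {B, - B}" "det B = 1"
    by (fastforce simp: lifts_def carrier_PSL2R)
  thus ?thesis by (auto simp: det_2)
qed


section \<open>The slash action and differentiation\<close>

text \<open>The additivity of \<open>powi\<close> in the exponent, and hence of the weight under multiplication,
  needs a nonzero automorphy factor.\<close>

lemma slash_mult:
  assumes "det A = 1" "\<tau> \<in> upper_half_plane"
  shows "slash (k + l) (\<lambda>t. f t * g t) A \<tau> = slash k f A \<tau> * slash l g A \<tau>"
proof -
  have "jfac A \<tau> powi (- (k + l)) = jfac A \<tau> powi (- k) * jfac A \<tau> powi (- l)"
    using power_int_add[of "jfac A \<tau>" "- k" "- l"] jfac_nonzero[OF assms] by simp
  thus ?thesis by (simp add: slash_def)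
qed

lemma slash_has_derivative:
  assumes "f holomorphic_on upper_half_plane" "det A = 1" "\<tau> \<in> upper_half_plane"
  shows "(slash k f A has_field_derivative
     slash (k + 2) (deriv f) A \<tau> - of_int k * Xfac A \<tau> * slash k f A \<tau>) (at \<tau>)"
proof -
  have j: "jfac A \<tau> \<noteq> 0" by (rule jfac_nonzero[OF assms(2,3)])
  have "(f has_field_derivative deriv f (mob A \<tau>)) (at (mob A \<tau>))"
    using holomorphic_derivI[OF assms(1) open_upper_half_plane]
      mob_in_upper_half_plane[OF assms(2,3)] by blast
  hence "((\<lambda>t. f (mob A t)) has_field_derivative
      deriv f (mob A \<tau>) * (1 / (jfac A \<tau>)\<^sup>2)) (at \<tau>)"
    by (rule DERIV_chain2[OF _ mob_has_derivative[OF assms(2,3)]])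
  hence D: "(slash k f A has_field_derivative
      of_int (- k) * jfac A \<tau> powi (- k - 1) * of_real (A$2$1) * f (mob A \<tau>)
      + deriv f (mob A \<tau>) * (1 / (jfac A \<tau>)\<^sup>2) * jfac A \<tau> powi (- k)) (at \<tau>)"
    unfolding slash_def[abs_def]
    by (intro DERIV_mult DERIV_power_int jfac_has_derivative disjI2 j)
  have 1: "jfac A \<tau> powi (- k - 1) = jfac A \<tau> powi (- k) / jfac A \<tau>"
    using j by (simp add: power_int_diff)
  have 2: "jfac A \<tau> powi (- (k + 2)) = jfac A \<tau> powi (- k) / (jfac A \<tau>)\<^sup>2"
    using j power_int_diff[of "jfac A \<tau>" "- k" 2] by simp
  show ?thesis
    by (rule DERIV_cong[OF D], unfold slash_def 1 2) (simp add: Xfac_def mult_ac)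
qed

lemma slash_holomorphic:
  assumes "f holomorphic_on upper_half_plane" "det A = 1"
  shows "slash k f A holomorphic_on upper_half_plane"
  using slash_has_derivative[OF assms] open_upper_half_plane
  by (auto simp: holomorphic_on_open)

lemma theta_holomorphic:
  assumes "f holomorphic_on upper_half_plane"
  shows "theta f holomorphic_on upper_half_plane"
  unfolding theta_def[abs_def]
  by (intro holomorphic_intros holomorphic_deriv[OF assms open_upper_half_plane])

text \<open>Solved for \<open>(\<theta> f)|A\<close>, the product rule measures how far \<open>\<theta>\<close> is from commuting with
  the slash action.\<close>

lemma slash_theta:
  assumes "f holomorphic_on upper_half_plane" "det A = 1" "\<tau> \<in> upper_half_plane"
  shows "slash (k + 2) (theta f) A \<tau> =
    theta (slash k f A) \<tau> + of_int k / (2 * of_real pi * \<i>) * Xfac A \<tau> * slash k f A \<tau>"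
proof -
  have "slash (k + 2) (deriv f) A \<tau> =
      deriv (slash k f A) \<tau> + of_int k * Xfac A \<tau> * slash k f A \<tau>"
    using DERIV_imp_deriv[OF slash_has_derivative[OF assms, of k]] by simp
  moreover have "slash (k + 2) (theta f) A \<tau> =
      1 / (2 * of_real pi * \<i>) * slash (k + 2) (deriv f) A \<tau>"
    by (simp add: slash_def theta_def)
  ultimately show ?thesis by (simp add: theta_def field_simps)
qed

text \<open>The derivative is local, so it is enough that two functions agree on the open
  half-plane.\<close>

lemma theta_cong:
  assumes "\<And>t. t \<in> upper_half_plane \<Longrightarrow> f t = g t" "\<tau> \<in> upper_half_plane"
  shows "theta f \<tau> = theta g \<tau>"
proof -
  have "\<forall>\<^sub>F t in nhds \<tau>. f t = g t"
    using eventually_nhds_in_open[OF open_upper_half_plane assms(2)]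
    by (rule eventually_mono) (rule assms(1))
  thus ?thesis unfolding theta_def by (metis deriv_cong_ev)
qed


section \<open>Boundedness towards infinity\<close>

lemma bounded_towards_infinity_cong:
  assumes "bounded_towards_infinity f" "\<And>t. t \<in> upper_half_plane \<Longrightarrow> f t = g t"
  shows "bounded_towards_infinity g"
  unfolding bounded_towards_infinity_def
proof (intro allI impI)
  fix K :: "real set" assume "compact K"
  then obtain Y B where "Y > 0" "\<And>t. Re t \<in> K \<and> Im t \<ge> Y \<Longrightarrow> norm (f t) \<le> B"
    using assms(1) unfolding bounded_towards_infinity_def by meson
  thus "\<exists>Y>0. \<exists>B. \<forall>t. Re t \<in> K \<and> Im t \<ge> Y \<longrightarrow> norm (g t) \<le> B"
    using assms(2) by (intro exI[of _ Y] conjI exI[of _ B]) (auto simp: upper_half_plane_def)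
qed

lemma bounded_towards_infinity_combine:
  assumes "bounded_towards_infinity f" "bounded_towards_infinity g"
    and op: "\<And>B C. \<exists>D. \<forall>t. norm (f t) \<le> B \<longrightarrow> norm (g t) \<le> C \<longrightarrow> norm (h t) \<le> D"
  shows "bounded_towards_infinity h"
  unfolding bounded_towards_infinity_def
proof (intro allI impI)
  fix K :: "real set" assume K: "compact K"
  obtain Y B where Y: "Y > 0" "\<And>t. Re t \<in> K \<and> Im t \<ge> Y \<Longrightarrow> norm (f t) \<le> B"
    using K assms(1) unfolding bounded_towards_infinity_def by meson
  obtain Z C where Z: "Z > 0" "\<And>t. Re t \<in> K \<and> Im t \<ge> Z \<Longrightarrow> norm (g t) \<le> C"
    using K assms(2) unfolding bounded_towards_infinity_def by meson
  obtain D where D: "\<And>t. norm (f t) \<le> B \<Longrightarrow> norm (g t) \<le> C \<Longrightarrow> norm (h t) \<le> D"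
    using op by blast
  show "\<exists>Y>0. \<exists>B. \<forall>t. Re t \<in> K \<and> Im t \<ge> Y \<longrightarrow> norm (h t) \<le> B"
    using Y Z D by (intro exI[of _ "max Y Z"] conjI exI[of _ D]) auto
qed

lemma bounded_towards_infinity_add:
  assumes "bounded_towards_infinity f" "bounded_towards_infinity g"
  shows "bounded_towards_infinity (\<lambda>t. f t + g t)"
  by (rule bounded_towards_infinity_combine[OF assms]) (meson norm_triangle_mono)

lemma bounded_towards_infinity_mult:
  assumes "bounded_towards_infinity f" "bounded_towards_infinity g"
  shows "bounded_towards_infinity (\<lambda>t. f t * g t)"
  by (rule bounded_towards_infinity_combine[OF assms]) (meson norm_mult_ineq norm_ge_zero mult_mono order_trans)

lemma bounded_towards_infinity_const: "bounded_towards_infinity (\<lambda>_. c)"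
  unfolding bounded_towards_infinity_def by (meson order_refl zero_less_one)

lemma bounded_towards_infinity_Xfac: "bounded_towards_infinity (Xfac A)"
  unfolding bounded_towards_infinity_def
proof (intro allI impI exI[of _ "1::real"] conjI)
  fix t :: complex and K :: "real set"
  assume t: "Re t \<in> K \<and> 1 \<le> Im t"
  have "\<bar>A$2$1\<bar> * 1 \<le> \<bar>A$2$1\<bar> * \<bar>Im t\<bar>" using t by (intro mult_left_mono) auto
  also have "\<dots> = \<bar>Im (jfac A t)\<bar>" by (simp add: jfac_def abs_mult)
  also have "\<dots> \<le> norm (jfac A t)" by (rule abs_Im_le_cmod)
  finally have le: "\<bar>A$2$1\<bar> \<le> norm (jfac A t)" by simp
  show "norm (Xfac A t) \<le> 1"
    using le by (cases "jfac A t = 0") (auto simp: Xfac_def norm_divide)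
qed simp

text \<open>Cauchy's inequality applies: discs of radius 1 around points of the strip stay in the strip widened by 1, as soon as
  the centres lie 1 higher than the region where the bound is known.\<close>

lemma bounded_towards_infinity_deriv:
  assumes hol: "g holomorphic_on upper_half_plane" and bd: "bounded_towards_infinity g"
  shows "bounded_towards_infinity (deriv g)"
  unfolding bounded_towards_infinity_def
proof (intro allI impI)
  fix K :: "real set" assume "compact K"
  then obtain R where R: "\<And>x. x \<in> K \<Longrightarrow> \<bar>x\<bar> \<le> R"
    using compact_imp_bounded bounded_real by metis
  obtain Y B where Y: "Y > 0"
    and B: "\<And>t. Re t \<in> {- R - 1..R + 1} \<and> Im t \<ge> Y \<Longrightarrow> norm (g t) \<le> B"
    using bd compact_Icc unfolding bounded_towards_infinity_def by meson
  have "norm (deriv g t) \<le> B" if t: "Re t \<in> K" "Im t \<ge> Y + 1" for t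
  proof -
    have near: "Re z \<in> {- R - 1..R + 1} \<and> Im z \<ge> Y" if "z \<in> cball t 1" for z
    proof -
      have "\<bar>Re (t - z)\<bar> \<le> 1" "\<bar>Im (t - z)\<bar> \<le> 1"
        using that abs_Re_le_cmod[of "t - z"] abs_Im_le_cmod[of "t - z"] by (auto simp: dist_norm)
      thus ?thesis using R[OF t(1)] t(2) by auto
    qed
    hence sub: "cball t 1 \<subseteq> upper_half_plane"
      using Y by (force simp: upper_half_plane_def)
    have hol': "g holomorphic_on cball t 1" by (rule holomorphic_on_subset[OF hol sub])
    have "norm ((deriv ^^ 1) g t) \<le> fact 1 * B / 1 ^ 1"
    proof (rule Cauchy_inequality)
      show "g holomorphic_on ball t 1" by (rule holomorphic_on_subset[OF hol']) auto
      show "continuous_on (cball t 1) g" by (rule holomorphic_on_imp_continuous_on[OF hol'])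
      show "norm (g z) \<le> B" if "norm (t - z) = 1" for z
        using that by (intro B near) (simp add: dist_norm)
    qed simp
    thus ?thesis by simp
  qed
  thus "\<exists>Y>0. \<exists>B. \<forall>t. Re t \<in> K \<and> Im t \<ge> Y \<longrightarrow> norm (deriv g t) \<le> B"
    using Y by (intro exI[of _ "Y + 1"] conjI exI[of _ B]) auto
qed

text \<open>In \<open>slash_theta\<close> every term on the right is bounded, so boundedness at a cusp survives
  differentiation, with the weight raised by 2.\<close>

lemma bounded_slash_theta:
  assumes hol: "f holomorphic_on upper_half_plane" and det: "det \<sigma> = 1"
    and bd: "bounded_towards_infinity (slash k f \<sigma>)"
  shows "bounded_towards_infinity (slash (k + 2) (theta f) \<sigma>)"
proof -
  have "bounded_towards_infinity (\<lambda>t. theta (slash k f \<sigma>) t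
      + of_int k / (2 * of_real pi * \<i>) * Xfac \<sigma> t * slash k f \<sigma> t)"
    unfolding theta_def
    by (intro bounded_towards_infinity_add bounded_towards_infinity_mult
        bounded_towards_infinity_const bounded_towards_infinity_Xfac
        bounded_towards_infinity_deriv slash_holomorphic hol det bd)
  thus ?thesis
    by (rule bounded_towards_infinity_cong) (simp add: slash_theta[OF hol det])
qed

lemma bounded_slash_mult:
  assumes "det \<sigma> = 1" "bounded_towards_infinity (slash k f \<sigma>)"
    "bounded_towards_infinity (slash l g \<sigma>)"
  shows "bounded_towards_infinity (slash (k + l) (\<lambda>t. f t * g t) \<sigma>)"
  by (rule bounded_towards_infinity_cong[OF bounded_towards_infinity_mult[OF assms(2,3)]])
     (simp add: slash_mult[OF assms(1)])

lemma slash_linear: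
  "slash k (\<lambda>t. a * f t + b * g t) A \<tau> = a * slash k f A \<tau> + b * slash k g A \<tau>"
  by (simp add: slash_def algebra_simps)

lemma bounded_slash_linear:
  assumes "bounded_towards_infinity (slash k f \<sigma>)" "bounded_towards_infinity (slash k g \<sigma>)"
  shows "bounded_towards_infinity (slash k (\<lambda>t. a * f t + b * g t) \<sigma>)"
  unfolding slash_linear[abs_def]
  by (intro bounded_towards_infinity_add bounded_towards_infinity_mult
      bounded_towards_infinity_const assms)


section \<open>Modular and quasimodular forms\<close>

text \<open>The component of index 0 of a quasimodular form is the form itself, so the condition at
  the cusps contains the boundedness of the form.\<close>

lemma quasimodular_bounded_at_cusp:
  assumes "f \<in> quasimodular_forms k \<Gamma>" "det \<sigma> = 1" "is_cusp \<Gamma> (mob_boundary \<sigma> None)"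
  shows "bounded_towards_infinity (slash k f \<sigma>)"
proof -
  obtain Q :: "nat \<Rightarrow> complex \<Rightarrow> complex" where Q: "\<And>t. t \<in> upper_half_plane \<Longrightarrow> Q 0 t = f t"
    "bounded_towards_infinity (slash (k - 2 * int 0) (Q 0) \<sigma>)"
    using assms unfolding quasimodular_forms_def by fastforce
  show ?thesis
    by (rule bounded_towards_infinity_cong[OF Q(2)])
       (simp add: slash_def Q(1) mob_in_upper_half_plane[OF assms(2)])
qed

lemma quasimodular_holomorphic:
  "f \<in> quasimodular_forms k \<Gamma> \<Longrightarrow> f holomorphic_on upper_half_plane"
  by (simp add: quasimodular_forms_def)

text \<open>An invariant form is quasimodular with the single component \<open>Q 0 = f\<close>.\<close>

lemma modular_formsI:
  assumes "f holomorphic_on upper_half_plane"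
    and "\<And>A \<tau>. A \<in> lifts \<Gamma> \<Longrightarrow> \<tau> \<in> upper_half_plane \<Longrightarrow> slash k f A \<tau> = f \<tau>"
    and "\<And>\<sigma>. det \<sigma> = 1 \<Longrightarrow> is_cusp \<Gamma> (mob_boundary \<sigma> None) \<Longrightarrow>
           bounded_towards_infinity (slash k f \<sigma>)"
  shows "f \<in> modular_forms k \<Gamma>"
  using assms unfolding modular_forms_def quasimodular_forms_def
  by (auto intro!: exI[of _ "0::nat"] exI[of _ "\<lambda>_. f"])

text \<open>With \<open>u = 1 / (2\<pi>i)\<close>, the \<open>X\<^sup>2\<close> terms in \<open>(\<theta> E)|A\<close> are \<open>- 12 u\<^sup>2 X\<^sup>2\<close> from
  differentiating \<open>X\<close> and \<open>24 u\<^sup>2 X\<^sup>2\<close> from the chain rule; twelve times their sum is the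
  \<open>(12 u X)\<^sup>2\<close> in the square of \<open>E + 12 u X\<close>.\<close>

lemma E4_of_modular:
  assumes sub: "subgroup \<Gamma> PSL2R" and E: "E \<in> quasimodular_forms 2 \<Gamma>"
    and tr: "\<And>A \<tau>. A \<in> lifts \<Gamma> \<Longrightarrow> \<tau> \<in> upper_half_plane \<Longrightarrow>
           slash 2 E A \<tau> = E \<tau> + 12 / (2 * of_real pi * \<i>) * Xfac A \<tau>"
  shows "E4_of E \<in> modular_forms 4 \<Gamma>"
proof (rule modular_formsI)
  note hol = quasimodular_holomorphic[OF E]
  have E4: "E4_of E = (\<lambda>t. 1 * (E t * E t) + (- 12) * theta E t)"
    by (simp add: E4_of_def fun_eq_iff power2_eq_square)
  show "E4_of E holomorphic_on upper_half_plane"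
    unfolding E4 by (intro holomorphic_intros hol theta_holomorphic)
  show "bounded_towards_infinity (slash 4 (E4_of E) \<sigma>)"
    if det: "det \<sigma> = 1" and cusp: "is_cusp \<Gamma> (mob_boundary \<sigma> None)" for \<sigma>
  proof -
    note bd = quasimodular_bounded_at_cusp[OF E det cusp]
    have "bounded_towards_infinity (slash 4 (theta E) \<sigma>)"
      using bounded_slash_theta[OF hol det bd] by simp
    moreover have "bounded_towards_infinity (slash 4 (\<lambda>t. E t * E t) \<sigma>)"
      using bounded_slash_mult[OF det bd bd] by simp
    ultimately show ?thesis unfolding E4 by (intro bounded_slash_linear)
  qed
  show "slash 4 (E4_of E) A \<tau> = E4_of E \<tau>" if A: "A \<in> lifts \<Gamma>" and \<tau>: "\<tau> \<in> upper_half_plane" for A \<tau>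
  proof -
    have det: "det A = 1" by (rule lifts_det[OF sub A])
    define u :: complex where "u = 1 / (2 * of_real pi * \<i>)"
    define X where "X = Xfac A \<tau>"
    have trA: "slash 2 E A t = E t + 12 * u * Xfac A t" if "t \<in> upper_half_plane" for t
      using tr[OF A that] by (simp add: u_def)
    have "((\<lambda>t. E t + 12 * u * Xfac A t) has_field_derivative
        deriv E \<tau> + 12 * u * (- X\<^sup>2)) (at \<tau>)"
      unfolding X_def
      by (intro DERIV_add DERIV_cmult Xfac_has_derivative det \<tau>
          holomorphic_derivI[OF hol open_upper_half_plane])
    hence "theta (\<lambda>t. E t + 12 * u * Xfac A t) \<tau> = theta E \<tau> - 12 * u\<^sup>2 * X\<^sup>2"
      unfolding theta_def u_def[symmetric]
      by (simp add: DERIV_imp_deriv algebra_simps power2_eq_square)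
    hence th: "theta (slash 2 E A) \<tau> = theta E \<tau> - 12 * u\<^sup>2 * X\<^sup>2"
      using theta_cong[OF trA \<tau>] by simp
    have "slash 4 (theta E) A \<tau> = theta (slash 2 E A) \<tau> + 2 * u * X * (E \<tau> + 12 * u * X)"
      using slash_theta[OF hol det \<tau>, of 2] trA[OF \<tau>] by (simp add: u_def X_def)
    moreover have "slash 4 (\<lambda>t. E t * E t) A \<tau> = (E \<tau> + 12 * u * X) * (E \<tau> + 12 * u * X)"
      using slash_mult[OF det \<tau>, of 2 2 E E] trA[OF \<tau>] by (simp add: X_def)
    ultimately show ?thesis
      unfolding E4 slash_linear th by (simp add: algebra_simps power2_eq_square)
  qed
qed

text \<open>The number 12 in the transformation law of \<open>E\<close> cancels the denominator of \<open>k / 12\<close>, leaving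
  the \<open>k u X h\<close> that the chain rule adds to \<open>\<theta> h\<close>.\<close>

lemma serre_deriv_modular:
  assumes sub: "subgroup \<Gamma> PSL2R" and E: "E \<in> quasimodular_forms 2 \<Gamma>"
    and tr: "\<And>A \<tau>. A \<in> lifts \<Gamma> \<Longrightarrow> \<tau> \<in> upper_half_plane \<Longrightarrow>
           slash 2 E A \<tau> = E \<tau> + 12 / (2 * of_real pi * \<i>) * Xfac A \<tau>"
    and h: "h \<in> modular_forms k \<Gamma>"
  shows "serre_deriv E k h \<in> modular_forms (k + 2) \<Gamma>"
proof (rule modular_formsI)
  have hq: "h \<in> quasimodular_forms k \<Gamma>"
    and inv: "\<And>A \<tau>. A \<in> lifts \<Gamma> \<Longrightarrow> \<tau> \<in> upper_half_plane \<Longrightarrow> slash k h A \<tau> = h \<tau>"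
    using h by (auto simp: modular_forms_def)
  note hol = quasimodular_holomorphic[OF hq]
  have S: "serre_deriv E k h = (\<lambda>t. 1 * theta h t + (- of_int k / 12) * (h t * E t))"
    by (simp add: serre_deriv_def fun_eq_iff)
  show "serre_deriv E k h holomorphic_on upper_half_plane"
    unfolding S
    by (intro holomorphic_intros hol theta_holomorphic quasimodular_holomorphic[OF E]) auto
  show "bounded_towards_infinity (slash (k + 2) (serre_deriv E k h) \<sigma>)"
    if det: "det \<sigma> = 1" and cusp: "is_cusp \<Gamma> (mob_boundary \<sigma> None)" for \<sigma>
    unfolding S using det cusp hol hq E
    by (intro bounded_slash_linear bounded_slash_theta bounded_slash_mult
        quasimodular_bounded_at_cusp)
  show "slash (k + 2) (serre_deriv E k h) A \<tau> = serre_deriv E k h \<tau>"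
    if A: "A \<in> lifts \<Gamma>" and \<tau>: "\<tau> \<in> upper_half_plane" for A \<tau>
  proof -
    have det: "det A = 1" by (rule lifts_det[OF sub A])
    define u :: complex where "u = 1 / (2 * of_real pi * \<i>)"
    have "slash (k + 2) (theta h) A \<tau> = theta h \<tau> + of_int k * u * Xfac A \<tau> * h \<tau>"
      using slash_theta[OF hol det \<tau>, of k] theta_cong[OF inv[OF A] \<tau>] inv[OF A \<tau>]
      by (simp add: u_def)
    moreover have "slash (k + 2) (\<lambda>t. h t * E t) A \<tau> = h \<tau> * (E \<tau> + 12 * u * Xfac A \<tau>)"
      using slash_mult[OF det \<tau>, of k 2 h E] tr[OF A \<tau>] inv[OF A \<tau>] by (simp add: u_def)
    ultimately show ?thesis
      unfolding S slash_linear by (simp add: algebra_simps)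
  qed
qed

theorem lemma5p4:
  fixes \<Gamma> :: "(real^2^2) set set" and E :: "complex \<Rightarrow> complex"
  assumes "fuchsian_first_kind \<Gamma>"
    and "\<exists>x. is_cusp \<Gamma> x"
    and "E \<in> quasimodular_forms 2 \<Gamma>"
    and "\<forall>A \<in> lifts \<Gamma>. \<forall>\<tau> \<in> upper_half_plane.
           slash 2 E A \<tau> = E \<tau> + 12 / (2 * of_real pi * \<i>) * Xfac A \<tau>"
  shows "(E4_of E \<in> modular_forms 4 \<Gamma> \<and>
          (\<forall>\<tau> \<in> upper_half_plane. theta E \<tau> = 1 / 12 * ((E \<tau>)\<^sup>2 - E4_of E \<tau>))) \<and>
         (\<forall>(k'::int) h. h \<in> modular_forms k' \<Gamma> \<longrightarrow>
            serre_deriv E k' h \<in> modular_forms (k' + 2) \<Gamma> \<and>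
            (\<forall>\<tau> \<in> upper_half_plane.
               theta h \<tau> = of_int k' / 12 * E \<tau> * h \<tau> + serre_deriv E k' h \<tau>))"
proof (intro conjI allI impI ballI)
  have sub: "subgroup \<Gamma> PSL2R" using assms(1) by (simp add: fuchsian_first_kind_def)
  have tr: "\<And>A \<tau>. A \<in> lifts \<Gamma> \<Longrightarrow> \<tau> \<in> upper_half_plane \<Longrightarrow>
      slash 2 E A \<tau> = E \<tau> + 12 / (2 * of_real pi * \<i>) * Xfac A \<tau>"
    using assms(4) by blast
  show "E4_of E \<in> modular_forms 4 \<Gamma>"
    by (rule E4_of_modular[OF sub assms(3) tr])
  show "theta E \<tau> = 1 / 12 * ((E \<tau>)\<^sup>2 - E4_of E \<tau>)" for \<tau>
    by (simp add: E4_of_def)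
  show "serre_deriv E k' h \<in> modular_forms (k' + 2) \<Gamma>" if "h \<in> modular_forms k' \<Gamma>" for k' h
    by (rule serre_deriv_modular[OF sub assms(3) tr that])
  show "theta h \<tau> = of_int k' / 12 * E \<tau> * h \<tau> + serre_deriv E k' h \<tau>" for k' h \<tau>
    by (simp add: serre_deriv_def)
qed

end
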